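(* Let $n\ge 1$ be an integer and let $\mathbb{T}=\{z\in\mathbb{C}:|z|=1\}$. Let $$P(z)=\prod_{j=1}^n (z-z_j),\qquad z_j=e^{it_j}\in\mathbb{T},\qquad 0\le t_1<t_2<\cdots<t_n<2\pi,\qquad t_{n+1}:=t_1+2\pi,$$ and let $$m:=\min_{1\le j\le n}\Bigl(\max_{t\in[t_j,t_{j+1}]}|P(e^{it})|\Bigr).$$ Then for every $z\in\mathbb{T}$, $$|P'(z)|^2\ \ge\ \Bigl(\frac n2\Bigr)^2\Bigl(|P(z)|^2+\bigl(m^2-|P(z)|^2\bigr)_+\Bigr)\ \ge\ \Bigl(\frac{nm}{2}\Bigr)^2,$$ where $(x)_+:=\max\{x,0\}$.
   Context: All notation is standard or introduced in the statement. *)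

theory Defs
  imports "HOL-Analysis.Analysis" "HOL-Computational_Algebra.Polynomial"
begin

(* The maximum over the arc is written as a supremum because Max is only meaningful on
   finite sets; for a \<le> b the supremum is attained, see arc_max_attained. *)
definition arc_max :: "complex poly \<Rightarrow> real \<Rightarrow> real \<Rightarrow> real" where
  "arc_max P a b = (SUP s\<in>{a..b}. cmod (poly P (cis s)))"

lemma arc_max_attained:
  assumes "a \<le> b"
  shows "\<exists>s\<in>{a..b}. arc_max P a b = cmod (poly P (cis s)) \<and>
           (\<forall>u\<in>{a..b}. cmod (poly P (cis u)) \<le> cmod (poly P (cis s)))"
proof -
  have "continuous_on {a..b} (\<lambda>s. cmod (poly P (cis s)))"
    by (intro continuous_intros)
  then obtain s where s: "s \<in> {a..b}"
    "\<forall>u\<in>{a..b}. cmod (poly P (cis u)) \<le> cmod (poly P (cis s))"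
    using continuous_attains_sup[of "{a..b}" "\<lambda>s. cmod (poly P (cis s))"] assms by auto
  have "arc_max P a b = cmod (poly P (cis s))"
    unfolding arc_max_def by (rule cSup_eq_maximum) (use s in auto)
  with s show ?thesis by blast
qed

end

theory Submission
  imports Defs
begin

(* On the circle P(e^{ix}) = c e^{inx/2} T(x) with |c| = 1 and T(x) = prod 2 sin((x - t_j)/2) real,
   so |P'|^2 = T'^2 + (n/2)^2 T^2. If this were below (n/2)^2 m^2 at x0, there would be a function
   C(x) = a cos(n(x - x0)/2) + b sin(n(x - x0)/2) of amplitude less than m that meets T at x0 and
   is steeper there, with b of either sign. T alternates with height at least m at n points per
   period, hence T - C has a zero between any two neighbouring ones; choosing the sign of b well
   makes the zero at x0 an additional one. But c e^{inx/2} (T - C)(x) is a polynomial of degree at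
   most n in e^{ix}, so it cannot have n + 1 zeros per period. *)

section \<open>Zeros of real functions and of polynomials on the circle\<close>

lemma sign_change_zero:
  fixes f :: "real \<Rightarrow> real"
  assumes "continuous_on UNIV f" "a < b" "f a * f b < 0"
  shows "\<exists>c. a < c \<and> c < b \<and> f c = 0"
proof -
  have cont: "continuous_on {a..b} f"
    using assms(1) continuous_on_subset by blast
  have nz: "f a \<noteq> 0" "f b \<noteq> 0" using assms(3) by auto
  consider "f a \<le> 0" "0 \<le> f b" | "f b \<le> 0" "0 \<le> f a"
    using assms(3) by (auto simp: mult_less_0_iff)
  then obtain c where "a \<le> c" "c \<le> b" "f c = 0"
    using IVT'[of f a 0 b] IVT2'[of f b 0 a] cont assms(2) by cases auto
  with nz show ?thesis by (metis order_le_less)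
qed

lemma steps_less_imp_le:
  fixes f :: "nat \<Rightarrow> real"
  assumes "\<And>i. i \<in> {1..n} \<Longrightarrow> f i < f (Suc i)" "1 \<le> k" "k \<le> l" "l \<le> Suc n"
  shows "f k \<le> f l"
  using assms(3,4)
proof (induction l rule: dec_induct)
  case (step l)
  then show ?case using assms(1)[of l] assms(2) by force
qed simp

text \<open>\<open>cis\<close> is injective on a half-open interval of length 2 pi, so distinct
  zeros on the real line become distinct roots of \<open>Q\<close>, and these number at most its
  degree. The half-open form keeps the two ends of a period from being counted as one root
  twice.\<close>

lemma card_circle_zeros_le:
  assumes "degree Q \<le> n" "\<And>x. x \<in> X \<Longrightarrow> poly Q (cis x) = 0"
    and "X \<subseteq> {u..<u + 2 * pi}" "Q \<noteq> 0"
  shows "card X \<le> n"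
proof -
  have inj: "inj_on cis X"
  proof (rule inj_onI)
    fix x y assume xy: "x \<in> X" "y \<in> X" "cis x = cis y"
    then have "cis (x - y) = 1" by (simp flip: cis_divide)
    then have "cos (x - y) = 1" by (metis cis.sel(1) one_complex.sel(1))
    then obtain k :: int where k: "x - y = of_int k * 2 * pi"
      using cos_one_2pi_int by auto
    have "x \<in> {u..<u + 2 * pi}" "y \<in> {u..<u + 2 * pi}" using xy assms(3) by blast+
    then have "\<bar>x - y\<bar> < 2 * pi" by auto
    then have "\<bar>of_int k\<bar> < (1::real)" by (simp add: k abs_mult)
    then have "k = 0" by linarith
    with k show "x = y" by simp
  qed
  have "card X = card (cis ` X)" by (simp add: card_image inj)
  also have "\<dots> \<le> card {w. poly Q w = 0}"
    by (rule card_mono) (use assms poly_roots_finite in auto)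
  also have "\<dots> \<le> degree Q" by (rule card_poly_roots_bound) fact
  finally show ?thesis using assms(1) by simp
qed

section \<open>Comparison with trigonometric functions of frequency n/2\<close>

lemma amplitude_bound:
  fixes a b :: real
  shows "\<bar>a * cos y + b * sin y\<bar> \<le> sqrt (a\<^sup>2 + b\<^sup>2)"
proof (rule real_le_rsqrt)
  \<comment> \<open>Lagrange's identity; dropping the second square gives the bound.\<close>
  have "(a * cos y + b * sin y)\<^sup>2 + (a * sin y - b * cos y)\<^sup>2 = (a\<^sup>2 + b\<^sup>2) * ((sin y)\<^sup>2 + (cos y)\<^sup>2)"
    by (simp only: power2_eq_square) algebra
  then show "\<bar>a * cos y + b * sin y\<bar>\<^sup>2 \<le> a\<^sup>2 + b\<^sup>2"
    using zero_le_power2[of "a * sin y - b * cos y"]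
    unfolding sin_cos_squared_add power2_abs mult_1_right by linarith
qed

text \<open>In exponentials, the trigonometric factor has only the frequencies n/2 and -n/2.
  Multiplying by \<open>cis (n * x / 2)\<close> shifts them to n and 0, which leaves a monomial of
  degree n plus a constant.\<close>

lemma half_frequency_polynomial:
  fixes n :: nat and a b u :: real
  shows "\<exists>Q. degree Q \<le> n \<and>
     (\<forall>x::real. poly Q (cis x) = cis (n * x / 2) *
        of_real (a * cos (n * (x - u) / 2) + b * sin (n * (x - u) / 2)))"
proof (intro exI conjI allI)
  let ?\<alpha> = "cis (- (n * u / 2)) * Complex (a / 2) (- (b / 2))"
  let ?\<beta> = "cis (n * u / 2) * Complex (a / 2) (b / 2)"
  let ?Q = "monom ?\<alpha> n + [:?\<beta>:]"
  show "degree ?Q \<le> n"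
    by (intro degree_add_le degree_monom_le) simp
  fix x :: real
  \<comment> \<open>After division by \<open>cis p\<close> the left side is a sum of two conjugates,
    hence real. It is used with \<open>p\<close> = nx/2, \<open>q\<close> = nu/2, \<open>A\<close> =
    a/2 and \<open>B\<close> = b/2.\<close>
  have identity: "cis (- q) * Complex A (- B) * (cis p * cis p) + cis q * Complex A B
      = cis p * of_real (2 * A * (cos p * cos q + sin p * sin q) + 2 * B * (sin p * cos q - cos p * sin q))"
    for A B p q :: real
  proof -
    have sq: "sin p * sin p = 1 - cos p * cos p"
      using sin_cos_squared_add[of p] by (simp add: power2_eq_square)
    have pyth: "sin p * (sin p * v) = v - cos p * (cos p * v)"
        "v * (sin p * sin p) = v - cos p * (cos p * v)" for v
      by (simp_all only: sq mult.assoc[symmetric]) (simp_all add: algebra_simps)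
    show ?thesis
      by (intro complex_eqI; simp add: algebra_simps pyth)
  qed
  have "cis x ^ n = cis (n * x / 2) * cis (n * x / 2)"
    by (simp add: Complex.DeMoivre cis_mult mult.commute)
  then have "poly ?Q (cis x) = ?\<alpha> * (cis (n * x / 2) * cis (n * x / 2)) + ?\<beta>"
    by (simp add: poly_monom)
  also have "\<dots> = cis (n * x / 2) *
        of_real (a * cos (n * x / 2 - n * u / 2) + b * sin (n * x / 2 - n * u / 2))"
    unfolding identity cos_diff sin_diff by simp
  finally show "poly ?Q (cis x) = cis (n * x / 2) *
        of_real (a * cos (n * (x - u) / 2) + b * sin (n * (x - u) / 2))"
    by (simp only: right_diff_distrib diff_divide_distrib)
qed

text \<open>The argument needs no sine product, only the representation of \<open>P\<close> through
  \<open>T\<close> and the alternation at points spanning one period. The index \<open>Suc n\<close>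
  closes the period, so that there are n arcs; \<open>e\<close> fixes the parity of the
  signs.\<close>

lemma alternation_derivative_bound:
  fixes T T' :: "real \<Rightarrow> real" and s :: "nat \<Rightarrow> real" and P :: "complex poly"
  assumes n: "n \<ge> 1" and deg: "degree P \<le> n" and "c \<noteq> 0"
    and P: "\<And>x::real. poly P (cis x) = c * cis (n * x / 2) * of_real (T x)"
    and T': "\<And>x. (T has_real_derivative T' x) (at x)"
    and s: "\<And>i. i \<in> {1..n} \<Longrightarrow> s i < s (Suc i)" "s (Suc n) = s 1 + 2 * pi"
    and alt: "\<And>i. i \<in> {1..Suc n} \<Longrightarrow> m \<le> (-1) ^ (e + i) * T (s i)" and "0 \<le> m"
    and x0: "s 1 \<le> x0" "x0 < s (Suc n)"
  shows "(n / 2)\<^sup>2 * m\<^sup>2 \<le> (T' x0)\<^sup>2 + (n / 2)\<^sup>2 * (T x0)\<^sup>2"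
proof (rule ccontr)
  define a where "a = T x0"
  assume "\<not> ?thesis"
  then have small: "(T' x0)\<^sup>2 < (n / 2)\<^sup>2 * (m\<^sup>2 - a\<^sup>2)"
    by (simp add: a_def right_diff_distrib)
  have n2: "real n / 2 > 0" using n by simp
  have am: "a\<^sup>2 < m\<^sup>2"
    using le_less_trans[OF zero_le_power2 small] n by (simp add: zero_less_mult_iff)
  have "\<bar>T' x0\<bar> < sqrt ((n / 2)\<^sup>2 * (m\<^sup>2 - a\<^sup>2))"
    using small by (intro real_less_rsqrt) simp
  also have "\<dots> = n / 2 * sqrt (m\<^sup>2 - a\<^sup>2)"
    using n2 by (simp add: real_sqrt_mult)
  finally have "\<bar>T' x0\<bar> / (n / 2) < sqrt (m\<^sup>2 - a\<^sup>2)"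
    using n2 by (simp add: field_simps)
  \<comment> \<open>The lower bound on \<open>b0\<close> will make the comparison function steeper
    than \<open>T\<close> at \<open>x0\<close>; the upper bound keeps its amplitude below
    \<open>m\<close>.\<close>
  then obtain b0 where b0: "\<bar>T' x0\<bar> / (n / 2) < b0" "b0 < sqrt (m\<^sup>2 - a\<^sup>2)"
    using dense by blast
  have b0_pos: "0 < b0"
    using le_less_trans[OF _ b0(1)] n2 by simp
  have b0_steep: "\<bar>T' x0\<bar> < n / 2 * b0"
    using b0(1) n2 by (simp add: field_simps)
  have "b0\<^sup>2 < (sqrt (m\<^sup>2 - a\<^sup>2))\<^sup>2"
    using b0(2) b0_pos by (intro power_strict_mono) auto
  then have amp: "sqrt (a\<^sup>2 + b0\<^sup>2) < m"
    using am \<open>0 \<le> m\<close> by (intro real_less_lsqrt) auto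
  have "\<exists>j\<in>{1..n}. s j \<le> x0 \<and> x0 < s (Suc j)"
  proof (rule ccontr)
    assume no: "\<not> ?thesis"
    have "k \<le> n \<Longrightarrow> s (Suc k) \<le> x0" for k
    proof (induction k)
      case 0 then show ?case using x0 by simp
    next
      case (Suc k) then show ?case using no by force
    qed
    then show False using x0 by force
  qed
  then obtain j where j: "j \<in> {1..n}" "s j \<le> x0" "x0 < s (Suc j)" by blast
  \<comment> \<open>\<open>\<delta>\<close> is the sign of \<open>T\<close> at \<open>s j\<close>.
    With coefficient \<open>- \<delta> * b0\<close> the function \<open>\<delta> * D\<close>
    increases through its zero at \<open>x0\<close>, so it is negative just to the left of
    \<open>x0\<close> although positive at \<open>s j\<close>.\<close>
  define \<delta> :: real where "\<delta> = (-1) ^ (e + j)"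
  have \<delta>: "\<delta> * \<delta> = 1" "\<delta>\<^sup>2 = 1" by (simp_all add: \<delta>_def flip: power_add power_mult)
  define C where "C = (\<lambda>x. a * cos (n * (x - x0) / 2) + (- \<delta> * b0) * sin (n * (x - x0) / 2))"
  define D where "D = (\<lambda>x. T x - C x)"
  have C_less: "\<bar>C x\<bar> < m" for x
    using amplitude_bound[of a "n * (x - x0) / 2" "- \<delta> * b0"] amp
    by (simp add: C_def power_mult_distrib \<delta>)
  \<comment> \<open>As |C| < m, subtracting \<open>C\<close> cannot change the sign of
    \<open>T\<close> at an alternation point.\<close>
  have D_sign: "0 < (-1) ^ (e + i) * D (s i)" if "i \<in> {1..Suc n}" for i
  proof -
    have "(-1) ^ (e + i) * C (s i) \<le> \<bar>C (s i)\<bar>"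
      by (rule order_trans[OF abs_ge_self]) (simp add: abs_mult)
    then show ?thesis
      using alt[OF that] C_less[of "s i"] by (simp add: D_def right_diff_distrib)
  qed
  have D_deriv: "(D has_real_derivative
      T' x - (- a * sin (n * (x - x0) / 2) * (n / 2) + (- \<delta> * b0) * cos (n * (x - x0) / 2) * (n / 2))) (at x)" for x
    unfolding D_def C_def
    by (rule T' derivative_eq_intros refl | (simp add: mult_ac; fail))+
  then have D_cont: "continuous_on UNIV D"
    by (intro continuous_at_imp_continuous_on ballI) (blast intro: DERIV_isCont)
  have D_x0: "D x0 = 0" by (simp add: D_def C_def a_def)
  have "((\<lambda>x. \<delta> * D x) has_real_derivative \<delta> * (T' x0 + \<delta> * b0 * (n / 2))) (at x0)"
    using DERIV_cmult[OF D_deriv[of x0], of \<delta>] by simp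
  moreover have "\<delta> * (T' x0 + \<delta> * b0 * (n / 2)) > 0"
  proof -
    have "\<delta> * T' x0 \<ge> - \<bar>T' x0\<bar>"
      using abs_ge_minus_self[of "\<delta> * T' x0"] by (simp add: abs_mult \<delta>_def)
    moreover have "\<delta> * (T' x0 + \<delta> * b0 * (n / 2)) = \<delta> * T' x0 + (\<delta> * \<delta>) * (n / 2 * b0)"
      by (simp add: algebra_simps)
    ultimately show ?thesis using b0_steep by (simp add: \<delta>)
  qed
  ultimately obtain d where d: "d > 0" "\<And>h. 0 < h \<Longrightarrow> h < d \<Longrightarrow> \<delta> * D (x0 - h) < 0"
    using DERIV_pos_inc_left[of "\<lambda>x. \<delta> * D x"] D_x0 by force
  have sj: "0 < \<delta> * D (s j)" using D_sign[of j] j by (simp add: \<delta>_def)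
  then have "s j < x0" using D_x0 j(2) by (cases "s j = x0") auto
  define h where "h = min d (x0 - s j) / 2"
  have h: "0 < h" "h < d" "h < x0 - s j"
    using d(1) \<open>s j < x0\<close> by (auto simp: h_def min_def)
  \<comment> \<open>The sign change happens before \<open>x0 - h\<close>, so the arc containing
    \<open>x0\<close> has a zero other than \<open>x0\<close> itself.\<close>
  have extra: "\<exists>r. s j < r \<and> r < x0 \<and> D r = 0"
  proof -
    have "D (s j) * D (x0 - h) = (\<delta> * D (s j)) * (\<delta> * D (x0 - h))"
      using \<delta>(1) by (metis mult.left_commute mult.assoc mult_1)
    also have "\<dots> < 0" using sj d(2)[OF h(1,2)] by (rule mult_pos_neg)
    finally show ?thesis
      using sign_change_zero[OF D_cont, of "s j" "x0 - h"] h by force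
  qed
  have s_mono: "s k \<le> s l" if "1 \<le> k" "k \<le> l" "l \<le> Suc n" for k l
    using steps_less_imp_le[of n s] s(1) that by blast
  \<comment> \<open>Every arc contributes a zero different from \<open>x0\<close>: arc
    \<open>j\<close> by \<open>extra\<close>, any other by the sign change between its ends, since
    \<open>x0\<close> lies outside it. Together with \<open>x0\<close> this makes n + 1
    zeros.\<close>
  have "\<exists>r. s i < r \<and> r < s (Suc i) \<and> D r = 0 \<and> r \<noteq> x0" if i: "i \<in> {1..n}" for i
  proof (cases "i = j")
    case True
    then show ?thesis using extra j(3) by force
  next
    case False
    have "D (s i) * D (s (Suc i)) = - (((-1) ^ (e + i) * D (s i)) * ((-1) ^ (e + Suc i) * D (s (Suc i))))"
      by (simp flip: power_add)
    also have "\<dots> < 0"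
      unfolding neg_less_0_iff_less using i by (intro mult_pos_pos D_sign) auto
    finally obtain r where r: "s i < r" "r < s (Suc i)" "D r = 0"
      using sign_change_zero[OF D_cont] s(1)[OF i] by blast
    have "r \<noteq> x0"
    proof (cases "i < j")
      case True
      then show ?thesis using s_mono[of "Suc i" j] r j by force
    next
      case False
      then show ?thesis using s_mono[of "Suc j" i] r i j \<open>i \<noteq> j\<close> by force
    qed
    with r show ?thesis by blast
  qed
  then obtain r where r: "\<And>i. i \<in> {1..n} \<Longrightarrow> s i < r i \<and> r i < s (Suc i) \<and> D (r i) = 0 \<and> r i \<noteq> x0"
    by metis
  have r_less: "r k < r l" if "k \<in> {1..n}" "l \<in> {1..n}" "k < l" for k l
    using r[OF that(1)] r[OF that(2)] s_mono[of "Suc k" l] that by force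
  have x0_notin: "x0 \<notin> r ` {1..n}" using r by blast
  have "inj_on r {1..n}"
    by (rule linorder_inj_onI') (metis r_less less_irrefl)
  then have "card (insert x0 (r ` {1..n})) = Suc n"
    using x0_notin by (simp add: card_image)
  moreover have "card (insert x0 (r ` {1..n})) \<le> n"
  proof -
    obtain Q where Q: "degree Q \<le> n" "\<And>x::real. poly Q (cis x) = cis (n * x / 2) * of_real (C x)"
      using half_frequency_polynomial[of n a x0 "- \<delta> * b0"] unfolding C_def by blast
    \<comment> \<open>The zeros of \<open>D\<close> thus become roots of a polynomial of degree at
      most n, which is nonzero because \<open>D (s 1)\<close> is.\<close>
    have R: "poly (P - smult c Q) (cis x) = c * cis (n * x / 2) * of_real (D x)" for x :: real
      by (simp add: P Q(2) D_def algebra_simps)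
    show ?thesis
    proof (rule card_circle_zeros_le)
      show "degree (P - smult c Q) \<le> n"
        using deg Q(1) degree_smult_le[of c Q] by (intro degree_diff_le) auto
      show "P - smult c Q \<noteq> 0"
        using R[of "s 1"] D_sign[of 1] \<open>c \<noteq> 0\<close> by auto
      show "poly (P - smult c Q) (cis x) = 0" if "x \<in> insert x0 (r ` {1..n})" for x
      proof -
        have "D x = 0" using that r D_x0 by auto
        then show ?thesis unfolding R by simp
      qed
      have "r i \<in> {s 1..<s 1 + 2 * pi}" if "i \<in> {1..n}" for i
        using r[OF that] s_mono[of 1 i] s_mono[of "Suc i" "Suc n"] s(2) that by force
      then show "insert x0 (r ` {1..n}) \<subseteq> {s 1..<s 1 + 2 * pi}"
        using x0 s(2) by auto
    qed
  qed
  ultimately show False by simp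
qed

section \<open>The real sine product behind \<open>P\<close>: factorization, derivative,
  signs\<close>

lemma cis_diff_cis:
  "cis x - cis y = \<i> * cis (y / 2) * cis (x / 2) * of_real (2 * sin ((x - y) / 2))"
proof -
  have *: "cis x = cis (x / 2) * cis (x / 2)" "cis y = cis (y / 2) * cis (y / 2)"
    by (simp_all add: cis_mult)
  have **: "sin ((x - y) / 2) = sin (x / 2) * cos (y / 2) - cos (x / 2) * sin (y / 2)"
    by (simp add: sin_diff diff_divide_distrib)
  have "sin u * sin u = 1 - cos u * cos u" for u :: real
    using sin_cos_squared_add[of u] by (simp add: power2_eq_square)
  note pyth = this[of "x / 2"] this[of "y / 2"]
  show ?thesis
    unfolding * ** by (rule complex_eqI; simp) (use pyth in algebra)+
qed

text \<open>The half-angle form of each chord separates a unimodular constant, a factor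
  \<open>cis (x / 2)\<close> and a real sine; the n middle factors combine to
  \<open>cis (n * x / 2)\<close>.\<close>

lemma prod_roots_on_circle:
  fixes n :: nat and t :: "nat \<Rightarrow> real" and x :: real
  shows "poly (\<Prod>j=1..n. [:- cis (t j), 1:]) (cis x)
     = (\<Prod>j=1..n. \<i> * cis (t j / 2)) * cis (n * x / 2) * of_real (\<Prod>j=1..n. 2 * sin ((x - t j) / 2))"
proof -
  have "poly (\<Prod>j=1..n. [:- cis (t j), 1:]) (cis x)
      = (\<Prod>j=1..n. \<i> * cis (t j / 2) * cis (x / 2) * of_real (2 * sin ((x - t j) / 2)))"
    unfolding cis_diff_cis[symmetric] by (simp add: poly_prod)
  also have "\<dots> = (\<Prod>j=1..n. \<i> * cis (t j / 2)) * cis (x / 2) ^ n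
      * of_real (\<Prod>j=1..n. 2 * sin ((x - t j) / 2))"
    unfolding of_real_prod by (simp only: prod.distrib prod_constant card_atLeastAtMost diff_Suc_1)
  finally show ?thesis by (simp only: Complex.DeMoivre times_divide_eq_right)
qed

text \<open>Differentiating \<open>P\<close> along the circle in two ways shows that i e^{ix}
  P'(e^{ix}) is a unimodular factor times T' + i (n/2) T, whose real and imaginary parts give the
  two squares.\<close>

lemma norm_pderiv_on_circle:
  fixes n :: nat and T :: "real \<Rightarrow> real"
  assumes P: "\<And>x::real. poly P (cis x) = c * cis (n * x / 2) * of_real (T x)"
    and T: "(T has_real_derivative T') (at x)" and "cmod c = 1"
  shows "(cmod (poly (pderiv P) (cis x)))\<^sup>2 = T'\<^sup>2 + (n / 2)\<^sup>2 * (T x)\<^sup>2"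
proof -
  have cis': "((\<lambda>x. cis (k * x)) has_vector_derivative of_real k * \<i> * cis (k * x)) (at x)" for k x
    unfolding cis_conv_exp
    by (auto intro!: derivative_eq_intros has_vector_derivative_real_field)
  have "((\<lambda>x. poly P (cis x)) has_vector_derivative \<i> * cis x * poly (pderiv P) (cis x)) (at x)"
    using field_vector_diff_chain_at[OF cis'[of 1 x] poly_DERIV] by (simp add: o_def)
  then have "((\<lambda>x. c * (cis (n / 2 * x) * of_real (T x))) has_vector_derivative
      \<i> * cis x * poly (pderiv P) (cis x)) (at x)"
    by (simp add: P mult.assoc)
  moreover have "((\<lambda>x. c * (cis (n / 2 * x) * of_real (T x))) has_vector_derivative
      c * (cis (n / 2 * x) * of_real T' + of_real (n / 2) * \<i> * cis (n / 2 * x) * of_real (T x))) (at x)"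
    by (intro has_vector_derivative_mult_right has_vector_derivative_mult cis'
        has_vector_derivative_of_real T)
  ultimately have "\<i> * cis x * poly (pderiv P) (cis x)
      = c * (cis (n / 2 * x) * of_real T' + of_real (n / 2) * \<i> * cis (n / 2 * x) * of_real (T x))"
    by (intro vector_derivative_unique_at)
  also have "\<dots> = c * cis (n / 2 * x) * Complex T' (n / 2 * T x)"
    by (simp add: Complex_eq algebra_simps)
  finally have "cmod (\<i> * cis x * poly (pderiv P) (cis x)) = cmod (c * cis (n / 2 * x) * Complex T' (n / 2 * T x))"
    by simp
  then show ?thesis
    using \<open>cmod c = 1\<close> by (simp add: norm_mult cmod_power2 power_mult_distrib power_divide)
qed

text \<open>All half angles lie strictly between -pi and pi, so the factors with k \<le> j are
  positive and the other n - j are negative; n - j and n + j have the same parity.\<close>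

lemma sine_product_sign:
  fixes t :: "nat \<Rightarrow> real"
  assumes mono: "\<And>k l. 1 \<le> k \<Longrightarrow> k \<le> l \<Longrightarrow> l \<le> Suc n \<Longrightarrow> t k \<le> t l"
    and per: "t (Suc n) = t 1 + 2 * pi"
    and j: "j \<in> {1..n}" and x: "t j < x" "x < t (Suc j)"
  shows "0 < (-1) ^ (n + j) * (\<Prod>k=1..n. 2 * sin ((x - t k) / 2))"
proof -
  have pos: "0 < (\<Prod>k\<in>{1..n}. (if k \<le> j then 1 else - 1) * (2 * sin ((x - t k) / 2)))"
  proof (rule prod_pos)
    fix k assume k: "k \<in> {1..n}"
    show "0 < (if k \<le> j then 1 else - 1) * (2 * sin ((x - t k) / 2))"
    proof (cases "k \<le> j")
      case True
      then have "0 < (x - t k) / 2" "(x - t k) / 2 < pi"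
        using mono[of k j] mono[of "Suc j" "Suc n"] mono[of 1 k] x j k per by force+
      then show ?thesis using True sin_gt_zero by simp
    next
      case False
      then have "0 < (t k - x) / 2" "(t k - x) / 2 < pi"
        using mono[of 1 j] mono[of "Suc j" k] mono[of k "Suc n"] x j k per by force+
      then have "0 < sin ((t k - x) / 2)" by (rule sin_gt_zero)
      moreover have "sin ((t k - x) / 2) = - sin ((x - t k) / 2)"
        by (metis minus_diff_eq minus_divide_left sin_minus)
      ultimately show ?thesis using False by simp
    qed
  qed
  have "{1..n} \<inter> - {k. k \<le> j} = {Suc j..n}" using j by auto
  then have "(\<Prod>k\<in>{1..n}. if k \<le> j then 1 else - 1 :: real) = (-1) ^ (n - j)"
    by (simp add: prod.If_cases)
  moreover have "(-1 :: real) ^ (n - j) = (-1) ^ (n + j)"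
    using j by (simp add: minus_one_power_iff)
  ultimately show ?thesis using pos by (simp only: prod.distrib)
qed

section \<open>Choice of the alternation points and conclusion\<close>

theorem theorem1p1:
  fixes n :: nat and t :: "nat \<Rightarrow> real" and P :: "complex poly" and m :: real and z :: complex
  assumes "n \<ge> 1"
    and "0 \<le> t 1" and "strict_mono_on {1..n} t" and "t n < 2 * pi"
    and "t (n + 1) = t 1 + 2 * pi"
    and "P = (\<Prod>j=1..n. [:- cis (t j), 1:])"
    and "m = (MIN j\<in>{1..n}. arc_max P (t j) (t (j + 1)))"
    and "cmod z = 1"
  shows "(cmod (poly (pderiv P) z))\<^sup>2
           \<ge> (real n / 2)\<^sup>2 * ((cmod (poly P z))\<^sup>2 + max (m\<^sup>2 - (cmod (poly P z))\<^sup>2) 0)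
       \<and> (real n / 2)\<^sup>2 * ((cmod (poly P z))\<^sup>2 + max (m\<^sup>2 - (cmod (poly P z))\<^sup>2) 0)
           \<ge> (real n * m / 2)\<^sup>2"
proof -
  define T where "T = (\<lambda>x. \<Prod>j=1..n. 2 * sin ((x - t j) / 2))"
  define c where "c = (\<Prod>j=1..n. \<i> * cis (t j / 2))"
  have P: "poly P (cis x) = c * cis (n * x / 2) * of_real (T x)" for x :: real
    unfolding T_def c_def assms(6) by (rule prod_roots_on_circle)
  have c: "cmod c = 1" by (simp add: c_def prod_norm[symmetric] norm_mult)
  have norm_P: "cmod (poly P (cis x)) = \<bar>T x\<bar>" for x
    by (simp add: P norm_mult c)
  have "\<exists>d. (T has_real_derivative d) (at x)" for x
  proof -
    have "((\<lambda>x. 2 * sin ((x - t j) / 2)) has_real_derivative cos ((x - t j) / 2)) (at x)" for j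
      by (auto intro!: derivative_eq_intros)
    then show ?thesis
      unfolding T_def
      using has_field_derivative_prod[of "{1..n}" "\<lambda>j x. 2 * sin ((x - t j) / 2)"
          "\<lambda>j. cos ((x - t j) / 2)" x] by fast
  qed
  then obtain T' where T': "\<And>x. (T has_real_derivative T' x) (at x)" by metis
  have deg: "degree P \<le> n"
    unfolding assms(6) by (rule order_trans[OF degree_prod_sum_le]) auto
  have t_step: "t i < t (Suc i)" if "i \<in> {1..n}" for i
  proof (cases "i = n")
    case True
    then show ?thesis using assms(2,4,5) by simp
  next
    case False
    then show ?thesis using assms(3) that by (auto simp: strict_mono_on_def)
  qed
  have t_mono: "t k \<le> t l" if "1 \<le> k" "k \<le> l" "l \<le> Suc n" for k l
    using steps_less_imp_le[of n t] t_step that by blast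
  have "\<exists>s\<in>{t j..t (Suc j)}. m \<le> \<bar>T s\<bar>" if j: "j \<in> {1..n}" for j
  proof -
    have "m \<le> arc_max P (t j) (t (Suc j))" using j by (simp add: assms(7))
    then show ?thesis
      using arc_max_attained[of "t j" "t (Suc j)" P] t_step[OF j] by (force simp: norm_P)
  qed
  then obtain s0 where s0: "\<And>j. j \<in> {1..n} \<Longrightarrow> s0 j \<in> {t j..t (Suc j)} \<and> m \<le> \<bar>T (s0 j)\<bar>"
    by metis
  have "arc_max P (t j) (t (Suc j)) \<ge> 0" if "j \<in> {1..n}" for j
    using arc_max_attained[of "t j" "t (Suc j)" P] t_step[OF that] by force
  then have "0 \<le> m" using assms(1) by (simp add: assms(7))
  \<comment> \<open>At the index \<open>Suc n\<close> the factor with index 1 vanishes, being a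
    multiple of sin pi.\<close>
  have T_zero: "T (t j) = 0" if "j \<in> {1..Suc n}" for j
  proof -
    have "sin ((t j - t (if j = Suc n then 1 else j)) / 2) = 0" using assms(5) by simp
    moreover have "(if j = Suc n then 1 else j) \<in> {1..n}" using that assms(1) by auto
    ultimately show ?thesis unfolding T_def by (intro prod_zero) auto
  qed
  \<comment> \<open>For \<open>m > 0\<close> the points \<open>s0 j\<close> cannot be ends of their
    arcs, where \<open>T\<close> vanishes; hence they are strictly ordered and the sign of
    \<open>T\<close> there is known.\<close>
  have key: "(n / 2)\<^sup>2 * m\<^sup>2 \<le> (T' x)\<^sup>2 + (n / 2)\<^sup>2 * (T x)\<^sup>2"
    if "m > 0" "s0 1 \<le> x" "x < s0 1 + 2 * pi" for x
  proof -
    define s where "s = (\<lambda>i. if i = Suc n then s0 1 + 2 * pi else s0 i)"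
    have s_in: "t j < s j \<and> s j < t (Suc j)" if "j \<in> {1..n}" for j
      using s0[OF that] T_zero[of j] T_zero[of "Suc j"] that \<open>m > 0\<close>
      by (cases "s0 j = t j"; cases "s0 j = t (Suc j)") (auto simp: s_def)
    have alt: "m \<le> (-1) ^ (n + i) * T (s i)" if i: "i \<in> {1..n}" for i
    proof -
      have "0 < (-1) ^ (n + i) * T (s i)"
        unfolding T_def using t_mono assms(5) i s_in[OF i]
        by (intro sine_product_sign) auto
      then have "(-1) ^ (n + i) * T (s i) = \<bar>(-1) ^ (n + i) * T (s i)\<bar>" by simp
      also have "\<dots> = \<bar>T (s i)\<bar>" by (simp add: abs_mult)
      finally have "\<bar>T (s i)\<bar> = (-1) ^ (n + i) * T (s i)" ..
      then show ?thesis using s0[OF i] i by (auto simp: s_def)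
    qed
    \<comment> \<open>Each sine changes sign under a shift by 2 pi. The resulting factor
      \<open>(-1) ^ n\<close> is what the alternation pattern requires at the closing point
      \<open>s (Suc n)\<close>.\<close>
    have T_per: "T (x + 2 * pi) = (-1) ^ n * T x" for x
    proof -
      have "sin ((x + 2 * pi - u) / 2) = - sin ((x - u) / 2)" for u
        using sin_periodic_pi[of "(x - u) / 2"] by (simp add: field_simps)
      then have "T (x + 2 * pi) = (\<Prod>j=1..n. (-1) * (2 * sin ((x - t j) / 2)))"
        unfolding T_def by simp
      then show ?thesis unfolding T_def by (simp only: prod.distrib) simp
    qed
    show ?thesis
    proof (rule alternation_derivative_bound[where s = s and e = n, OF assms(1) deg _ P T'])
      show "s i < s (Suc i)" if "i \<in> {1..n}" for i
      proof (cases "i = n")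
        case True
        then have "s i < t 1 + 2 * pi" "t 1 < s 1" "s (Suc i) = s 1 + 2 * pi"
          using s_in[of n] s_in[of 1] assms(1,5) by (auto simp: s_def)
        then show ?thesis by simp
      next
        case False
        then show ?thesis using s_in[of i] s_in[of "Suc i"] that by force
      qed
      show "m \<le> (-1) ^ (n + i) * T (s i)" if "i \<in> {1..Suc n}" for i
      proof (cases "i = Suc n")
        case True
        then show ?thesis using alt[of 1] assms(1) by (simp add: s_def T_per flip: power_add)
      qed (use alt that in auto)
    qed (use that assms(1) c \<open>0 \<le> m\<close> in \<open>auto simp: s_def\<close>)
  qed
  \<comment> \<open>The argument of \<open>z\<close> is taken in the period starting at
    \<open>s0 1\<close>, where \<open>key\<close> applies.\<close>
  obtain x where x: "s0 1 \<le> x" "x < s0 1 + 2 * pi" "z = cis x"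
  proof -
    define y where "y = Arg2pi (z / cis (s0 1))"
    have "z / cis (s0 1) = cis y"
      using Arg2pi_eq[of "z / cis (s0 1)"] assms(8) by (simp add: y_def norm_divide cis_conv_exp)
    then have z: "z = cis (s0 1 + y)" by (simp add: field_simps flip: cis_mult)
    have "0 \<le> y" "y < 2 * pi" unfolding y_def by (rule Arg2pi_ge_0 Arg2pi_lt_2pi)+
    with z show ?thesis by (intro that[of "s0 1 + y"]) simp_all
  qed
  have bound: "(n / 2)\<^sup>2 * m\<^sup>2 \<le> (T' x)\<^sup>2 + (n / 2)\<^sup>2 * (T x)\<^sup>2"
    using key[of x] x \<open>0 \<le> m\<close> by (cases "m = 0") auto
  \<comment> \<open>With the bracket equal to the larger of m^2 and T^2, the first inequality splits
    into \<open>bound\<close> and the dropping of T'^2, and the second is immediate.\<close>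
  have "(cmod (poly P z))\<^sup>2 + max (m\<^sup>2 - (cmod (poly P z))\<^sup>2) 0 = max (m\<^sup>2) ((T x)\<^sup>2)"
    by (simp add: x(3) norm_P max_def)
  moreover have "(cmod (poly (pderiv P) z))\<^sup>2 = (T' x)\<^sup>2 + (n / 2)\<^sup>2 * (T x)\<^sup>2"
    unfolding x(3) by (rule norm_pderiv_on_circle[OF P T' c])
  moreover have "(real n * m / 2)\<^sup>2 = (n / 2)\<^sup>2 * m\<^sup>2"
    by (simp add: power_mult_distrib power_divide)
  ultimately show ?thesis using bound by (auto simp: max_def mult_left_mono)
qed

end
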